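(* Let $(X,d)$ be a metric space satisfying the uniform betweenness property with modulus of uniform betweenness $\Theta:(0,\infty)^3\to(0,\infty)$. Let $b\in\mathbb{R}$ satisfy $b\ge \operatorname{diam}(X)>0$, let $D>0$, and let $N\in\mathbb{N}$ be such that $b+1<ND$. Put $\Theta_b(\varepsilon):=\Theta(\varepsilon,\varepsilon,b)$ for $\varepsilon>0$ and assume $\Theta_b(\varepsilon)\le\varepsilon$ for all $\varepsilon>0$. Let $\langle (M_n),(L_n)\rangle$ be a Lion-Man game in $X$ with speed $D$. Then for every $\varepsilon>0$, every $\alpha$ with $$0<\alpha\le\min\left\{\frac1N,\frac{\varepsilon}{2},\frac D2\right\},$$ and every integer $$n\ \ge\ N+N\left\lceil \frac{b}{\Theta_b^{(N)}(\alpha)}\right\rceil ,$$ where $\Theta_b^{(N)}$ is the $N$-fold composition of $\Theta_b$ with itself, we have $$d(L_n,M_n)<D+\varepsilon .$$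
   Context: Uniform betweenness property: a metric space $(X,d)$ satisfies it if for all $a,b,\varepsilon>0$ there is $\theta>0$ such that for all $x,y,z,w\in X$: if $\operatorname{sep}\{x,y,z,w\}\ge a$, $\operatorname{diam}\{x,y,z,w\}\le b$, $d(x,y)+d(y,z)\le d(x,z)+\theta$ and $d(y,z)+d(z,w)\le d(y,w)+\theta$, then $d(x,z)+d(z,w)\le d(x,w)+\varepsilon$. Here $\operatorname{diam}\{x,y,z,w\}$ is the largest of the pairwise distances, and $\operatorname{sep}\{x,y,z,w\}\ge a$ means that the four points are pairwise distinct and all six pairwise distances are $\ge a$. A function $\Theta:(0,\infty)^3\to(0,\infty)$ such that $\theta=\Theta(\varepsilon,a,b)$ works for all $\varepsilon,a,b>0$ is called a modulus of uniform betweenness (note the order of arguments $(\varepsilon,a,b)$). Lion-Man game with speed $D>0$ in a metric space $(X,d)$: a pair $\langle (M_n),(L_n)\rangle$ of sequences in $X$ (indexed by $n=0,1,2,\dots$) such that for all $n$: $d(M_n,M_{n+1})\le D$, $d(L_{n+1},L_n)+d(L_{n+1},M_n)=d(L_n,M_n)$, and $d(L_n,L_{n+1})=\min\{D,d(L_n,M_n)\}$. *)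

theory Defs
  imports "HOL-Analysis.Analysis"
begin

text \<open>A metric space is a carrier \<open>X\<close> with a distance \<open>d\<close>, as in the locale \<^locale>\<open>Metric_space\<close>.
  Its diameter is extended-real-valued, so that \<open>mdiam X d \<le> ereal b\<close> entails boundedness.\<close>

definition mdiam :: "'a set \<Rightarrow> ('a \<Rightarrow> 'a \<Rightarrow> real) \<Rightarrow> ereal" where
  "mdiam X d = (SUP p \<in> X \<times> X. ereal (d (fst p) (snd p)))"

definition sep4_ge :: "('a \<Rightarrow> 'a \<Rightarrow> real) \<Rightarrow> 'a \<Rightarrow> 'a \<Rightarrow> 'a \<Rightarrow> 'a \<Rightarrow> real \<Rightarrow> bool" where
  "sep4_ge d x y z w a \<longleftrightarrow>
     distinct [x, y, z, w] \<and>
     (\<forall>r \<in> {d x y, d x z, d x w, d y z, d y w, d z w}. a \<le> r)"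

definition diam4 :: "('a \<Rightarrow> 'a \<Rightarrow> real) \<Rightarrow> 'a \<Rightarrow> 'a \<Rightarrow> 'a \<Rightarrow> 'a \<Rightarrow> real" where
  "diam4 d x y z w = Max {d x y, d x z, d x w, d y z, d y w, d z w}"

definition betweenness_witness ::
  "'a set \<Rightarrow> ('a \<Rightarrow> 'a \<Rightarrow> real) \<Rightarrow> real \<Rightarrow> real \<Rightarrow> real \<Rightarrow> real \<Rightarrow> bool" where
  "betweenness_witness X d \<epsilon> a b \<theta> \<longleftrightarrow>
     (\<forall>x\<in>X. \<forall>y\<in>X. \<forall>z\<in>X. \<forall>w\<in>X.
        sep4_ge d x y z w a \<longrightarrow>
        diam4 d x y z w \<le> b \<longrightarrow>
        d x y + d y z \<le> d x z + \<theta> \<longrightarrow>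
        d y z + d z w \<le> d y w + \<theta> \<longrightarrow>
        d x z + d z w \<le> d x w + \<epsilon>)"

definition uniform_betweenness :: "'a set \<Rightarrow> ('a \<Rightarrow> 'a \<Rightarrow> real) \<Rightarrow> bool" where
  "uniform_betweenness X d \<longleftrightarrow>
     (\<forall>a>0. \<forall>b>0. \<forall>\<epsilon>>0. \<exists>\<theta>>0. betweenness_witness X d \<epsilon> a b \<theta>)"

text \<open>Only the values of \<open>\<Theta>\<close> at positive arguments matter: it represents a function
  from triples of positive reals to positive reals, with arguments in the order \<open>\<epsilon>, a, b\<close>.\<close>

definition modulus_of_uniform_betweenness ::
  "'a set \<Rightarrow> ('a \<Rightarrow> 'a \<Rightarrow> real) \<Rightarrow> (real \<Rightarrow> real \<Rightarrow> real \<Rightarrow> real) \<Rightarrow> bool" where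
  "modulus_of_uniform_betweenness X d \<Theta> \<longleftrightarrow>
     (\<forall>\<epsilon>>0. \<forall>a>0. \<forall>b>0. 0 < \<Theta> \<epsilon> a b \<and> betweenness_witness X d \<epsilon> a b (\<Theta> \<epsilon> a b))"

lemma modulus_imp_uniform_betweenness:
  "modulus_of_uniform_betweenness X d \<Theta> \<Longrightarrow> uniform_betweenness X d"
  unfolding modulus_of_uniform_betweenness_def uniform_betweenness_def by blast

definition diag_modulus :: "(real \<Rightarrow> real \<Rightarrow> real \<Rightarrow> real) \<Rightarrow> real \<Rightarrow> real \<Rightarrow> real" where
  "diag_modulus \<Theta> b \<epsilon> = \<Theta> \<epsilon> \<epsilon> b"

definition lion_man_game ::
  "'a set \<Rightarrow> ('a \<Rightarrow> 'a \<Rightarrow> real) \<Rightarrow> real \<Rightarrow> (nat \<Rightarrow> 'a) \<Rightarrow> (nat \<Rightarrow> 'a) \<Rightarrow> bool" where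
  "lion_man_game X d D M L \<longleftrightarrow>
     (\<forall>n. M n \<in> X \<and> L n \<in> X \<and>
        d (M n) (M (Suc n)) \<le> D \<and>
        d (L (Suc n)) (L n) + d (L (Suc n)) (M n) = d (L n) (M n) \<and>
        d (L n) (L (Suc n)) = min D (d (L n) (M n)))"

end

theory Submission
  imports Defs
begin

text \<open>Suppose \<open>d(L\<^sub>n, M\<^sub>n) \<ge> D + \<epsilon>\<close>. The distances \<open>d(L\<^sub>k, M\<^sub>k)\<close>, \<open>k \<le> n\<close>, are then nonincreasing
  and at least \<open>D + \<epsilon>\<close>, so by the pigeonhole principle some block of \<open>N\<close> consecutive moves loses at most
  \<open>\<delta> = \<Theta>\<^sub>b\<^sup>N(\<alpha>)\<close>. Inside this block \<open>L\<^sub>k, L\<^sub>k\<^sub>+\<^sub>1, M\<^sub>k\<close> are collinear and \<open>L\<^sub>k\<^sub>+\<^sub>1, M\<^sub>k, M\<^sub>k\<^sub>+\<^sub>1\<close> are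
  collinear up to \<open>\<delta>\<close>. Applying uniform betweenness to \<open>L\<^sub>k, L\<^sub>k\<^sub>+\<^sub>1, M\<^sub>k\<^sub>+\<^sub>j, M\<^sub>k\<^sub>+\<^sub>j\<^sub>+\<^sub>1\<close> in both orders,
  by induction on \<open>j\<close>, shows that the lion's trajectory is nearly geodesic: \<open>d(L\<^sub>i, M\<^sub>i\<^sub>+\<^sub>N)\<close> is at
  least \<open>N (D - \<alpha>) \<ge> N D - 1 > b\<close>, which is absurd.\<close>

lemma exists_small_decrement:
  fixes f :: "nat \<Rightarrow> real"
  assumes "0 < K" and "f 0 - f K \<le> real K * \<delta>"
  shows "\<exists>j<K. f j - f (Suc j) \<le> \<delta>"
proof (rule ccontr)
  assume "\<not> ?thesis"
  then have "(\<Sum>j<K. \<delta>) < (\<Sum>j<K. f j - f (Suc j))"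
    using \<open>0 < K\<close> by (intro sum_strict_mono) auto
  with assms(2) show False
    by (simp add: sum_lessThan_telescope')
qed

lemma dist_le_of_mdiam_le:
  assumes "mdiam X d \<le> ereal b" "x \<in> X" "y \<in> X"
  shows "d x y \<le> b"
proof -
  have "ereal (d x y) \<le> mdiam X d"
    unfolding mdiam_def using assms(2,3) by (intro SUP_upper2[of "(x, y)"]) auto
  with assms(1) show ?thesis
    using ereal_less_eq(3) order_trans by blast
qed

text \<open>The hypotheses are invariant under reversing the quadruple to \<open>w, z, y, x\<close>,
  so the same \<theta> also controls the position of \<open>y\<close> between \<open>x\<close> and
  \<open>w\<close>.\<close>

lemma betweenness_witness_both:
  assumes "Metric_space X d" and wit: "betweenness_witness X d e a b \<theta>" and "0 < a"
    and X: "x \<in> X" "y \<in> X" "z \<in> X" "w \<in> X"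
    and sep: "a \<le> d x y" "a \<le> d x z" "a \<le> d x w" "a \<le> d y z" "a \<le> d y w" "a \<le> d z w"
    and diam: "\<And>u v. u \<in> X \<Longrightarrow> v \<in> X \<Longrightarrow> d u v \<le> b"
    and xyz: "d x y + d y z \<le> d x z + \<theta>" and yzw: "d y z + d z w \<le> d y w + \<theta>"
  shows "d x z + d z w \<le> d x w + e" and "d x y + d y w \<le> d x w + e"
proof -
  interpret Metric_space X d by fact
  have dist: "distinct [x, y, z, w]"
    using sep \<open>0 < a\<close> X by auto
  have "sep4_ge d x y z w a" "diam4 d x y z w \<le> b"
    using dist sep X by (auto simp: sep4_ge_def diam4_def intro: diam)
  with wit X xyz yzw show "d x z + d z w \<le> d x w + e"
    unfolding betweenness_witness_def by blast
  have "sep4_ge d w z y x a" "diam4 d w z y x \<le> b"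
    using dist sep X by (auto simp: sep4_ge_def diam4_def commute intro: diam)
  moreover have "d w z + d z y \<le> d w y + \<theta>" "d z y + d y x \<le> d z x + \<theta>"
    using xyz yzw by (simp_all add: commute)
  ultimately have "d w y + d y x \<le> d w x + e"
    using wit X unfolding betweenness_witness_def by blast
  then show "d x y + d y w \<le> d x w + e"
    by (simp add: commute)
qed

lemma diag_modulus_pos:
  assumes "modulus_of_uniform_betweenness X d \<Theta>" "0 < b" "0 < e"
  shows "0 < diag_modulus \<Theta> b e"
  using assms by (simp add: modulus_of_uniform_betweenness_def diag_modulus_def)

lemma betweenness_witness_diag_modulus:
  assumes "modulus_of_uniform_betweenness X d \<Theta>" "0 < b" "0 < e"
  shows "betweenness_witness X d e e b (diag_modulus \<Theta> b e)"
  using assms by (simp add: modulus_of_uniform_betweenness_def diag_modulus_def)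

lemma funpow_pos_le:
  fixes f :: "real \<Rightarrow> real"
  assumes "\<And>e. 0 < e \<Longrightarrow> 0 < f e" "\<And>e. 0 < e \<Longrightarrow> f e \<le> e" "0 < a"
  shows "0 < (f ^^ m) a \<and> (f ^^ m) a \<le> a"
  using assms(3) by (induction m) (auto intro: assms(1) order_trans[OF assms(2)])

lemma lion_man_game_in:
  assumes "lion_man_game X d D M L"
  shows "M n \<in> X" "L n \<in> X"
  using assms by (auto simp: lion_man_game_def)

text \<open>The lion approaches the old position of the man by exactly \<open>D\<close>, and the
  man's move wins back at most \<open>D\<close>.\<close>

lemma lion_step_far:
  assumes "Metric_space X d" "lion_man_game X d D M L" "D \<le> d (L n) (M n)"
  shows "d (L n) (L (Suc n)) = D" "d (L (Suc n)) (M n) = d (L n) (M n) - D"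
    "d (L (Suc n)) (M (Suc n)) \<le> d (L n) (M n)"
proof -
  interpret Metric_space X d by fact
  note game = assms(2)[unfolded lion_man_game_def, rule_format, of n]
  show 1: "d (L n) (L (Suc n)) = D"
    using game assms(3) by simp
  then show 2: "d (L (Suc n)) (M n) = d (L n) (M n) - D"
    using game commute[of "L n" "L (Suc n)"] by simp
  show "d (L (Suc n)) (M (Suc n)) \<le> d (L n) (M n)"
    using triangle[of "L (Suc n)" "M n" "M (Suc n)"] 2 game lion_man_game_in[OF assms(2)]
    by auto
qed

text \<open>Here the lion lands on \<open>M n\<close>, and the man then gets at most
  \<open>D\<close> away. Contrapositively, a distance above \<open>D\<close> at one time forces the
  same at all earlier times.\<close>

lemma lion_step_near:
  assumes "Metric_space X d" "lion_man_game X d D M L" "d (L n) (M n) \<le> D"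
  shows "d (L (Suc n)) (M (Suc n)) \<le> D"
proof -
  interpret Metric_space X d by fact
  note game = assms(2)[unfolded lion_man_game_def, rule_format, of n]
  have "d (L (Suc n)) (M n) = 0"
    using game assms(3) commute[of "L n" "L (Suc n)"] by simp
  then show ?thesis
    using triangle[of "L (Suc n)" "M n" "M (Suc n)"] game lion_man_game_in[OF assms(2)]
    by auto
qed

lemma lion_dist_mono:
  assumes "Metric_space X d" "lion_man_game X d D M L" "D < d (L n) (M n)" "k \<le> m" "m \<le> n"
  shows "d (L m) (M m) \<le> d (L k) (M k)"
proof -
  have far: "D < d (L j) (M j)" if "j \<le> n" for j
    using that assms(3)
    by (induction rule: inc_induct) (auto dest: lion_step_near[OF assms(1,2)] simp: not_le[symmetric])
  show ?thesis
    using assms(4,5)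
  proof (induction rule: dec_induct)
    case (step q)
    then show ?case
      using lion_step_far(3)[OF assms(1,2) less_imp_le[OF far[of q]]] by simp
  qed simp
qed

text \<open>Here \<open>e j\<close> is the error in the near-collinearities that involve the man
  \<open>j\<close> moves ahead of the lion. Looking one move further ahead costs one use of
  betweenness, which turns \<open>e j\<close> into \<open>e (Suc j)\<close>, and raises the lower
  bound by \<open>D - \<alpha>\<close>.\<close>

lemma lion_nearly_geodesic:
  assumes "Metric_space X d"
    and game: "lion_man_game X d D M L"
    and diam: "\<And>u v. u \<in> X \<Longrightarrow> v \<in> X \<Longrightarrow> d u v \<le> b"
    and e_pos: "\<And>j. 0 < e j" and e_le: "\<And>j. e j \<le> \<alpha>"
    and wit: "\<And>j. j < N \<Longrightarrow> betweenness_witness X d (e (Suc j)) (e (Suc j)) b (e j)"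
    and \<alpha>: "\<alpha> \<le> \<epsilon>" "2 * \<alpha> \<le> D"
    and far: "\<And>k. i \<le> k \<Longrightarrow> k \<le> i + N \<Longrightarrow> D + \<epsilon> \<le> d (L k) (M k)"
    and small: "\<And>k. i \<le> k \<Longrightarrow> k < i + N \<Longrightarrow> d (L k) (M k) - d (L (Suc k)) (M (Suc k)) \<le> e 0"
  shows "D + \<epsilon> + real N * (D - \<alpha>) \<le> d (L i) (M (i + N))"
proof -
  interpret Metric_space X d by fact
  note inX = lion_man_game_in[OF game]
  have \<alpha>_pos: "0 < \<alpha>"
    using e_pos[of 0] e_le[of 0] by simp
  have M_step: "d (M k) (M (Suc k)) \<le> D" for k
    using game by (auto simp: lion_man_game_def)
  have far': "D \<le> d (L k) (M k)" if "i \<le> k" "k \<le> i + N" for k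
    using far[OF that] \<alpha> \<alpha>_pos by simp
  note step = lion_step_far[OF assms(1) game far']
  \<comment> \<open>The lion gains \<open>D\<close> in each step, so a net drop of at most
    \<open>e 0\<close> forces the man to run at nearly full speed.\<close>
  have M_step_ge: "D - \<alpha> \<le> d (M k) (M (Suc k))" if "i \<le> k" "k < i + N" for k
    using triangle[of "L (Suc k)" "M k" "M (Suc k)"] inX small[OF that] e_le[of 0] step(2)[of k] that
    by auto
  \<comment> \<open>The claims need a joint induction: the first two at \<open>j\<close> are the two
    betweenness hypotheses, and the third provides the separation. The strict range in the second
    keeps \<open>M (Suc (k + j))\<close> inside the block.\<close>
  have "(\<forall>k. i \<le> k \<and> k + j \<le> i + N \<longrightarrow>
          d (L k) (L (Suc k)) + d (L (Suc k)) (M (k + j)) \<le> d (L k) (M (k + j)) + e j) \<and>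
        (\<forall>k. i \<le> k \<and> k + j < i + N \<longrightarrow>
          d (L (Suc k)) (M (k + j)) + d (M (k + j)) (M (Suc (k + j)))
            \<le> d (L (Suc k)) (M (Suc (k + j))) + e j) \<and>
        (\<forall>k. i \<le> k \<and> k + j \<le> i + N \<longrightarrow>
          D + \<epsilon> + real j * (D - \<alpha>) \<le> d (L k) (M (k + j)))"
    if "j \<le> N" for j
    using that
  proof (induction j)
    case 0
    have "d (L k) (L (Suc k)) + d (L (Suc k)) (M k) \<le> d (L k) (M k) + e 0"
      if "i \<le> k" "k \<le> i + N" for k
      using that step(1,2)[of k] e_pos[of 0] by simp
    moreover have "d (L (Suc k)) (M k) + d (M k) (M (Suc k)) \<le> d (L (Suc k)) (M (Suc k)) + e 0"
      if "i \<le> k" "k < i + N" for k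
      using that step(2)[of k] M_step[of k] small[of k] by simp
    ultimately show ?case
      using far by simp
  next
    case (Suc j)
    have key: "d (L k) (M (k + j)) + d (M (k + j)) (M (Suc (k + j)))
          \<le> d (L k) (M (Suc (k + j))) + e (Suc j)"
      "d (L k) (L (Suc k)) + d (L (Suc k)) (M (Suc (k + j))) \<le> d (L k) (M (Suc (k + j))) + e (Suc j)"
      "D + \<epsilon> + real j * (D - \<alpha>) \<le> d (L (Suc k)) (M (Suc (k + j)))"
      if k: "i \<le> k" "k + j < i + N" for k
    proof -
      let ?x = "L k" and ?y = "L (Suc k)" and ?z = "M (k + j)" and ?w = "M (Suc (k + j))"
      have IH: "d ?x ?y + d ?y ?z \<le> d ?x ?z + e j"
          "d ?y ?z + d ?z ?w \<le> d ?y ?w + e j"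
          "D + \<epsilon> + real j * (D - \<alpha>) \<le> d ?x ?z"
        using Suc k by auto
      have "i \<le> Suc k \<and> Suc k + j \<le> i + N"
        using k by simp
      then show IH': "D + \<epsilon> + real j * (D - \<alpha>) \<le> d ?y ?w"
        using Suc by (metis Suc_leD add_Suc)
      have xy: "d ?x ?y = D"
        using step(1)[of k] k by simp
      have zw: "d ?z ?w \<le> D" "D - \<alpha> \<le> d ?z ?w"
        using M_step M_step_ge[of "k + j"] k by simp_all
      have "0 \<le> real j * (D - \<alpha>)"
        using \<alpha> \<alpha>_pos by simp
      then have far_xz: "D + \<epsilon> \<le> d ?x ?z" and far_yw: "D + \<epsilon> \<le> d ?y ?w"
        using IH(3) IH' by linarith+
      \<comment> \<open>The surplus \<epsilon> over \<open>D\<close> survives the man's step from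
        \<open>?z\<close> to \<open>?w\<close>, which has length at most \<open>D\<close>; this
        separates the two pairs not bounded so far.\<close>
      have "\<epsilon> \<le> d ?x ?w"
        using triangle[of ?x ?w ?z] inX far_xz zw(1) commute[of ?w ?z] by simp
      moreover have "\<epsilon> \<le> d ?y ?z"
        using triangle[of ?y ?z ?w] inX far_yw zw(1) by simp
      ultimately have sep: "e (Suc j) \<le> d ?x ?y" "e (Suc j) \<le> d ?x ?z" "e (Suc j) \<le> d ?x ?w"
          "e (Suc j) \<le> d ?y ?z" "e (Suc j) \<le> d ?y ?w" "e (Suc j) \<le> d ?z ?w"
        using e_le[of "Suc j"] \<alpha> \<alpha>_pos xy zw(2) far_xz far_yw by linarith+
      have "betweenness_witness X d (e (Suc j)) (e (Suc j)) b (e j)"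
        using wit Suc.prems by simp
      note bw = betweenness_witness_both[OF assms(1) this e_pos inX(2) inX(2) inX(1) inX(1)
          sep diam IH(1,2)]
      show "d ?x ?z + d ?z ?w \<le> d ?x ?w + e (Suc j)" "d ?x ?y + d ?y ?w \<le> d ?x ?w + e (Suc j)"
        using bw by simp_all
    qed
    \<comment> \<open>The lion's step of length \<open>D\<close> is put in front of the bound for
      \<open>Suc k\<close>, at a loss of \<open>e (Suc j) \<le> \<alpha>\<close>.\<close>
    have "D + \<epsilon> + real (Suc j) * (D - \<alpha>) \<le> d (L k) (M (Suc (k + j)))"
      if k: "i \<le> k" "k + j < i + N" for k
      using key(2,3)[OF k] step(1)[of k] k e_le[of "Suc j"] by (simp add: algebra_simps)
    \<comment> \<open>This is the quadruple starting at \<open>Suc k\<close>, whence the shifted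
      range of \<open>k\<close>.\<close>
    moreover have "d (L (Suc k)) (M (Suc (k + j))) + d (M (Suc (k + j))) (M (Suc (Suc (k + j))))
        \<le> d (L (Suc k)) (M (Suc (Suc (k + j)))) + e (Suc j)"
      if "i \<le> k" "Suc (k + j) < i + N" for k
      using key(1)[of "Suc k"] that by simp
    ultimately show ?case
      using key(2) by simp
  qed
  from this[of N] show ?thesis by simp
qed

theorem theorem2p7:
  fixes X :: "'a set" and d :: "'a \<Rightarrow> 'a \<Rightarrow> real"
    and \<Theta> :: "real \<Rightarrow> real \<Rightarrow> real \<Rightarrow> real"
    and b D \<epsilon> \<alpha> :: real and N n :: nat
    and M L :: "nat \<Rightarrow> 'a"
  assumes "Metric_space X d"
    and "uniform_betweenness X d"
    and "modulus_of_uniform_betweenness X d \<Theta>"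
    and "0 < mdiam X d" and "mdiam X d \<le> ereal b"
    and "D > 0"
    and "b + 1 < real N * D"
    and "\<And>e. e > 0 \<Longrightarrow> diag_modulus \<Theta> b e \<le> e"
    and "lion_man_game X d D M L"
    and "\<epsilon> > 0"
    and "0 < \<alpha>" and "\<alpha> \<le> Min {1 / real N, \<epsilon> / 2, D / 2}"
    and "int n \<ge> int N + int N * \<lceil>b / (diag_modulus \<Theta> b ^^ N) \<alpha>\<rceil>"
  shows "d (L n) (M n) < D + \<epsilon>"
proof (rule ccontr)
  interpret Metric_space X d by fact
  note game = assms(9) and inX = lion_man_game_in[OF assms(9)]
  note dist_le = dist_le_of_mdiam_le[OF assms(5)]
  have "0 < ereal b"
    using assms(4,5) by (rule less_le_trans)
  then have b: "0 < b" by simp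
  then have N: "0 < N"
    using assms(7) by (cases N) auto
  have \<alpha>: "\<alpha> \<le> 1 / real N" "\<alpha> \<le> \<epsilon>" "2 * \<alpha> \<le> D"
    using assms(10,12) by auto
  \<comment> \<open>The iterates are indexed backwards, so that \<open>e 0\<close> is the finest
    tolerance, \<open>e N = \<alpha>\<close>, and each \<open>e j\<close> is the modulus at
    \<open>e (Suc j)\<close>.\<close>
  define e where "e j = (diag_modulus \<Theta> b ^^ (N - j)) \<alpha>" for j
  have e: "0 < e j" "e j \<le> \<alpha>" for j
    unfolding e_def using funpow_pos_le[OF diag_modulus_pos[OF assms(3) b] assms(8,11)] by auto
  have wit: "betweenness_witness X d (e (Suc j)) (e (Suc j)) b (e j)" if "j < N" for j
  proof -
    have "e j = diag_modulus \<Theta> b (e (Suc j))"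
      using that by (simp add: e_def flip: Suc_diff_Suc)
    then show ?thesis
      using betweenness_witness_diag_modulus[OF assms(3) b e(1)] by simp
  qed

  assume "\<not> d (L n) (M n) < D + \<epsilon>"
  then have n_far: "D + \<epsilon> \<le> d (L n) (M n)" "D < d (L n) (M n)"
    using assms(10) by auto
  note mono = lion_dist_mono[OF assms(1) game n_far(2)]

  \<comment> \<open>With \<open>K\<close> blocks of length \<open>N\<close> and a total drop of at
    most \<open>b\<close>, the average drop per block is at most \<open>e 0\<close>.\<close>
  define K where "K = nat \<lceil>b / e 0\<rceil>"
  have K: "0 < K" "b \<le> real K * e 0"
    using b e(1)[of 0] by (auto simp: K_def pos_divide_le_eq[symmetric] of_nat_ceiling)
  have "int (N * K) \<le> int n"
    using assms(13) b e(1)[of 0] by (simp add: K_def e_def)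
  then have NK: "N * K \<le> n"
    by (simp only: of_nat_le_iff)
  have "d (L (N * 0)) (M (N * 0)) - d (L (N * K)) (M (N * K)) \<le> real K * e 0"
    using dist_le[OF inX(2) inX(1), of 0 0] nonneg[of "L (N * K)" "M (N * K)"] K(2)
    unfolding mult_0_right by linarith
  from exists_small_decrement[of K "\<lambda>j. d (L (N * j)) (M (N * j))", OF K(1) this]
  obtain j where j: "j < K"
    "d (L (N * j)) (M (N * j)) - d (L (N * Suc j)) (M (N * Suc j)) \<le> e 0"
    by blast
  define i where "i = N * j"
  have "N * Suc j \<le> N * K"
    using j(1) by (intro mult_le_mono2) simp
  with NK have iN: "i + N \<le> n"
    by (simp add: i_def)
  have drop: "d (L i) (M i) - d (L (i + N)) (M (i + N)) \<le> e 0"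
    using j(2) by (simp add: i_def add.commute)
  have "D + \<epsilon> + real N * (D - \<alpha>) \<le> d (L i) (M (i + N))"
  proof (rule lion_nearly_geodesic[where e = e, OF assms(1) game dist_le e wit \<alpha>(2,3)])
    show "D + \<epsilon> \<le> d (L k) (M k)" if "i \<le> k" "k \<le> i + N" for k
      using mono[of k n] that iN n_far(1) by simp
    \<comment> \<open>By monotonicity a single step loses no more than its whole block.\<close>
    show "d (L k) (M k) - d (L (Suc k)) (M (Suc k)) \<le> e 0" if "i \<le> k" "k < i + N" for k
      using mono[of i k] mono[of "Suc k" "i + N"] that iN drop by simp
  qed
  moreover have "d (L i) (M (i + N)) \<le> b"
    by (intro dist_le inX)
  \<comment> \<open>The accumulated loss fits into the slack of 1 in
    \<open>b + 1 < real N * D\<close>.\<close>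
  moreover have "real N * \<alpha> \<le> 1"
    using \<alpha>(1) N by (simp add: field_simps)
  ultimately show False
    using assms(6,7,10) by (simp add: algebra_simps)
qed

end
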